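(* Let $\mathcal{M}$ be the following infinitely branching MDP. There is a controlled state $s$, a controlled state $t$, and random states $r_i$ for $i\ge 1$. The successors of $s$ are all $r_i$ ($i\ge1$), with reward $0$. From $r_i$ the MDP moves to $t$ with probability $2^{-i}$ (reward $-1$) and to $s$ with probability $1-2^{-i}$ (reward $0$). The only successor of $t$ is $s$, with reward $+1$. (Thus the total reward accumulated from $s$ is determined by the current state: $0$ at $s$ and at each $r_i$, $-1$ at $t$.) Consider the objective $\mathit{TP}_{\liminf\ge 0}=\{\rho\mid \liminf_{n\to\infty}\sum_{j=0}^{n-1} r(e_j)\ge 0\}$. Then (1) every finite-memory randomized (FR) strategy $\sigma$ satisfies $\mathcal{P}_{\mathcal{M},s,\sigma}(\mathit{TP}_{\liminf\ge 0})=0$; (2) there exists a history-dependent deterministic (HD) strategy $\sigma$ with $\mathcal{P}_{\mathcal{M},s,\sigma}(\mathit{TP}_{\liminf\ge 0})=1$. Hence optimal (and even almost-surely winning) strategies and $\varepsilon$-optimal strategies for $\mathit{TP}_{\liminf\ge 0}$ require infinite memory beyond a reward counter.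
   Context: In an MDP, a strategy assigns to each finite partial run ending in a controlled state a probability distribution over that state's successors; random states move according to fixed distributions; an initial state and strategy induce a probability measure $\mathcal{P}_{\mathcal{M},s,\sigma}$ on runs $s_0e_0s_1e_1\dots$ where $e_j$ are transitions with rewards $r(e_j)$. A strategy is finite-memory randomized (FR) if it can be implemented with a finite set of memory modes, an initial mode, and a (possibly randomized) function mapping the current mode and state to a distribution over pairs (next mode, successor), consistent with the fixed distributions at random states. HD strategies are arbitrary history-dependent strategies with Dirac choices. A reward counter strategy has memory recording only the sum of all transition rewards seen so far. Almost-surely winning means winning with probability $1$; $\varepsilon$-optimal means attaining at least the supremum over strategies minus $\varepsilon$. *)

theory Defs
  imports "HOL-Probability.Probability"
begin

section \<open>Countable Markov decision processes\<close>

text \<open>States are the elements of a countable type. A transition is a pair of states, so the run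
  \<open>s\<^sub>0 e\<^sub>0 s\<^sub>1 e\<^sub>1 \<dots>\<close> is determined by its state sequence; runs are represented as functions
  \<open>nat \<Rightarrow> 's\<close> and partial runs as nonempty lists. The field \<open>trans_prob\<close> is only
  meaningful at random states, i.e. outside \<open>controlled\<close>, and \<open>reward\<close> only on \<open>edges\<close>.\<close>

record 's mdp =
  controlled :: "'s set"
  edges :: "('s \<times> 's) set"
  trans_prob :: "'s \<Rightarrow> 's pmf"
  reward :: "'s \<times> 's \<Rightarrow> real"

definition wf_mdp :: "('s::countable) mdp \<Rightarrow> bool" where
  "wf_mdp M \<longleftrightarrow> (\<forall>s. \<exists>t. (s, t) \<in> edges M) \<and>
     (\<forall>s. s \<notin> controlled M \<longrightarrow> set_pmf (trans_prob M s) = edges M `` {s})"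

definition is_run :: "('s::countable) mdp \<Rightarrow> (nat \<Rightarrow> 's) \<Rightarrow> bool" where
  "is_run M \<omega> \<longleftrightarrow> (\<forall>j. (\<omega> j, \<omega> (Suc j)) \<in> edges M)"

definition partial_run :: "('s::countable) mdp \<Rightarrow> 's list \<Rightarrow> bool" where
  "partial_run M \<rho> \<longleftrightarrow> \<rho> \<noteq> [] \<and> (\<forall>j. Suc j < length \<rho> \<longrightarrow> (\<rho> ! j, \<rho> ! Suc j) \<in> edges M)"

definition total_reward :: "('s::countable) mdp \<Rightarrow> 's list \<Rightarrow> real" where
  "total_reward M \<rho> = (\<Sum>j<length \<rho> - 1. reward M (\<rho> ! j, \<rho> ! Suc j))"

type_synonym 's strat = "'s list \<Rightarrow> 's pmf"

definition strategy :: "('s::countable) mdp \<Rightarrow> 's strat \<Rightarrow> bool" where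
  "strategy M \<sigma> \<longleftrightarrow> (\<forall>\<rho>. partial_run M \<rho> \<and> last \<rho> \<in> controlled M \<longrightarrow>
     set_pmf (\<sigma> \<rho>) \<subseteq> edges M `` {last \<rho>})"

definition HD_strategy :: "('s::countable) mdp \<Rightarrow> 's strat \<Rightarrow> bool" where
  "HD_strategy M \<sigma> \<longleftrightarrow> strategy M \<sigma> \<and>
     (\<forall>\<rho>. partial_run M \<rho> \<and> last \<rho> \<in> controlled M \<longrightarrow> (\<exists>t. \<sigma> \<rho> = return_pmf t))"


section \<open>The probability measure on runs\<close>

definition next_state :: "('s::countable) mdp \<Rightarrow> 's strat \<Rightarrow> 's list \<Rightarrow> 's pmf" where
  "next_state M \<sigma> \<rho> = (if last \<rho> \<in> controlled M then \<sigma> \<rho> else trans_prob M (last \<rho>))"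

definition run_kernel :: "('s::countable) mdp \<Rightarrow> 's \<Rightarrow> 's strat \<Rightarrow> nat \<Rightarrow> (nat \<Rightarrow> 's) \<Rightarrow> 's measure" where
  "run_kernel M s \<sigma> n \<omega> =
     measure_pmf (if n = 0 then return_pmf s else next_state M \<sigma> (map \<omega> [0..<n]))"

text \<open>The Ionescu-Tulcea extension of the one-step kernels. Its values on cylinder sets are given
  by \<open>measure_run_cylinder\<close> below.\<close>

definition run_measure :: "('s::countable) mdp \<Rightarrow> 's \<Rightarrow> 's strat \<Rightarrow> (nat \<Rightarrow> 's) measure" where
  "run_measure M s \<sigma> =
     projective_family.lim UNIV (Ionescu_Tulcea.CI (run_kernel M s \<sigma>) (\<lambda>_. count_space UNIV))
       (\<lambda>_. count_space UNIV)"

definition run_prob :: "('s::countable) mdp \<Rightarrow> 's \<Rightarrow> 's strat \<Rightarrow> (nat \<Rightarrow> 's) set \<Rightarrow> real" where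
  "run_prob M s \<sigma> A = measure (run_measure M s \<sigma>) A"


section \<open>Memory-based strategies\<close>

text \<open>A transducer \<open>\<tau>\<close> maps a memory mode and a state to a distribution over pairs of next
  mode and next state.\<close>

definition transducer ::
    "('s::countable) mdp \<Rightarrow> 'm set \<Rightarrow> ('m \<Rightarrow> 's \<Rightarrow> ('m \<times> 's) pmf) \<Rightarrow> bool" where
  "transducer M Q \<tau> \<longleftrightarrow> (\<forall>m\<in>Q. \<forall>s.
     fst ` set_pmf (\<tau> m s) \<subseteq> Q \<and>
     (if s \<in> controlled M then snd ` set_pmf (\<tau> m s) \<subseteq> edges M `` {s}
      else map_pmf snd (\<tau> m s) = trans_prob M s))"

text \<open>Joint distribution of the first \<open>n + 1\<close> states and the current mode in the Markov chain
  on pairs of mode and state that \<open>\<tau>\<close> generates from \<open>(m\<^sub>0, s)\<close>.\<close>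

primrec history ::
    "('m \<Rightarrow> 's \<Rightarrow> ('m \<times> 's) pmf) \<Rightarrow> 'm \<Rightarrow> 's::countable \<Rightarrow> nat \<Rightarrow> ('s list \<times> 'm) pmf" where
  "history \<tau> m\<^sub>0 s 0 = return_pmf ([s], m\<^sub>0)"
| "history \<tau> m\<^sub>0 s (Suc n) =
     bind_pmf (history \<tau> m\<^sub>0 s n)
       (\<lambda>(\<rho>, m). map_pmf (\<lambda>(m', s'). (\<rho> @ [s'], m')) (\<tau> m (last \<rho>)))"

definition possible ::
    "('m \<Rightarrow> 's \<Rightarrow> ('m \<times> 's) pmf) \<Rightarrow> 'm \<Rightarrow> 's::countable \<Rightarrow> 's list \<Rightarrow> bool" where
  "possible \<tau> m\<^sub>0 s \<rho> \<longleftrightarrow> \<rho> \<in> fst ` set_pmf (history \<tau> m\<^sub>0 s (length \<rho> - 1))"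

definition mode_dist ::
    "('m \<Rightarrow> 's \<Rightarrow> ('m \<times> 's) pmf) \<Rightarrow> 'm \<Rightarrow> 's::countable \<Rightarrow> 's list \<Rightarrow> 'm pmf" where
  "mode_dist \<tau> m\<^sub>0 s \<rho> =
     map_pmf snd (cond_pmf (history \<tau> m\<^sub>0 s (length \<rho> - 1)) {h. fst h = \<rho>})"

definition induced_strat ::
    "('m \<Rightarrow> 's \<Rightarrow> ('m \<times> 's) pmf) \<Rightarrow> 'm \<Rightarrow> 's::countable \<Rightarrow> 's strat" where
  "induced_strat \<tau> m\<^sub>0 s \<rho> =
     bind_pmf (mode_dist \<tau> m\<^sub>0 s \<rho>) (\<lambda>m. map_pmf snd (\<tau> m (last \<rho>)))"

text \<open>The conditional distribution of the mode, and hence the induced strategy, is only determined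
  on partial runs of positive probability.\<close>

definition implements ::
    "('s::countable) mdp \<Rightarrow> 's \<Rightarrow> ('m \<Rightarrow> 's \<Rightarrow> ('m \<times> 's) pmf) \<Rightarrow> 'm \<Rightarrow> 's strat \<Rightarrow> bool" where
  "implements M s \<tau> m\<^sub>0 \<sigma> \<longleftrightarrow>
     (\<forall>\<rho>. last \<rho> \<in> controlled M \<and> possible \<tau> m\<^sub>0 s \<rho> \<longrightarrow> \<sigma> \<rho> = induced_strat \<tau> m\<^sub>0 s \<rho>)"

text \<open>A finite set of modes can be renamed into the natural numbers, so using modes of type
  \<^typ>\<open>nat\<close> is no restriction.\<close>

definition FR_strategy :: "('s::countable) mdp \<Rightarrow> 's \<Rightarrow> 's strat \<Rightarrow> bool" where
  "FR_strategy M s \<sigma> \<longleftrightarrow> strategy M \<sigma> \<and>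
     (\<exists>(Q :: nat set) m\<^sub>0 \<tau>. finite Q \<and> m\<^sub>0 \<in> Q \<and> transducer M Q \<tau> \<and> implements M s \<tau> m\<^sub>0 \<sigma>)"

text \<open>Finite memory together with a reward counter: the memory is a pair of a mode from a finite
  set and the sum of all transition rewards seen so far. A reward counter strategy is the special
  case of a single mode.\<close>

definition counts_reward ::
    "('s::countable) mdp \<Rightarrow> 'q set \<Rightarrow> ('q \<times> real \<Rightarrow> 's \<Rightarrow> (('q \<times> real) \<times> 's) pmf) \<Rightarrow> bool" where
  "counts_reward M Q \<tau> \<longleftrightarrow>
     (\<forall>q\<in>Q. \<forall>x s q' x' s'. ((q', x'), s') \<in> set_pmf (\<tau> (q, x) s) \<longrightarrow> x' = x + reward M (s, s'))"

definition FR_reward_counter_strategy :: "('s::countable) mdp \<Rightarrow> 's \<Rightarrow> 's strat \<Rightarrow> bool" where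
  "FR_reward_counter_strategy M s \<sigma> \<longleftrightarrow> strategy M \<sigma> \<and>
     (\<exists>(Q :: nat set) q\<^sub>0 \<tau>. finite Q \<and> q\<^sub>0 \<in> Q \<and> transducer M (Q \<times> UNIV) \<tau> \<and>
        counts_reward M Q \<tau> \<and> implements M s \<tau> (q\<^sub>0, 0) \<sigma>)"


section \<open>Objectives and optimality\<close>

definition TP_liminf_ge_0 :: "('s::countable) mdp \<Rightarrow> (nat \<Rightarrow> 's) set" where
  "TP_liminf_ge_0 M = {\<omega>. is_run M \<omega> \<and>
     liminf (\<lambda>n. ereal (\<Sum>j<n. reward M (\<omega> j, \<omega> (Suc j)))) \<ge> 0}"

definition mdp_value :: "('s::countable) mdp \<Rightarrow> 's \<Rightarrow> (nat \<Rightarrow> 's) set \<Rightarrow> real" where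
  "mdp_value M s A = (SUP \<sigma>\<in>{\<sigma>. strategy M \<sigma>}. run_prob M s \<sigma> A)"

definition almost_surely_winning ::
    "('s::countable) mdp \<Rightarrow> 's \<Rightarrow> (nat \<Rightarrow> 's) set \<Rightarrow> 's strat \<Rightarrow> bool" where
  "almost_surely_winning M s A \<sigma> \<longleftrightarrow> strategy M \<sigma> \<and> run_prob M s \<sigma> A = 1"

definition eps_optimal ::
    "('s::countable) mdp \<Rightarrow> 's \<Rightarrow> (nat \<Rightarrow> 's) set \<Rightarrow> real \<Rightarrow> 's strat \<Rightarrow> bool" where
  "eps_optimal M s A \<epsilon> \<sigma> \<longleftrightarrow> strategy M \<sigma> \<and> run_prob M s \<sigma> A \<ge> mdp_value M s A - \<epsilon>"

definition optimal :: "('s::countable) mdp \<Rightarrow> 's \<Rightarrow> (nat \<Rightarrow> 's) set \<Rightarrow> 's strat \<Rightarrow> bool" where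
  "optimal M s A \<sigma> \<longleftrightarrow> strategy M \<sigma> \<and> run_prob M s \<sigma> A = mdp_value M s A"


section \<open>The infinitely branching example\<close>

text \<open>\<open>R i\<close> is the random state \<open>r\<close> with index \<open>i + 1\<close>, so that \<open>i\<close> ranges over all naturals.\<close>

datatype state = S | T | R nat

instance state :: countable
  by countable_datatype

definition ex_mdp :: "state mdp" where
  "ex_mdp = \<lparr>
     controlled = {S, T},
     edges = (\<Union>i. {(S, R i), (R i, T), (R i, S)}) \<union> {(T, S)},
     trans_prob = (\<lambda>s. case s of
         R i \<Rightarrow> map_pmf (\<lambda>b. if b then T else S) (bernoulli_pmf ((1 / 2) ^ (i + 1)))
       | _ \<Rightarrow> return_pmf S),
     reward = (\<lambda>e. case e of (R i, T) \<Rightarrow> - 1 | (T, S) \<Rightarrow> 1 | _ \<Rightarrow> 0) \<rparr>"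


section \<open>Adequacy of the definitions\<close>

lemma sets_PiM_count_space_finite:
  "finite I \<Longrightarrow> sets (PiM I (\<lambda>_. count_space (UNIV :: 's::countable set))) = Pow (PiE I (\<lambda>_. UNIV))"
  by (simp add: count_space_PiM_finite)

lemma Ionescu_Tulcea_run_kernel:
  fixes M :: "('s::countable) mdp"
  shows "Ionescu_Tulcea (run_kernel M s \<sigma>) (\<lambda>_. count_space (UNIV :: 's set))"
proof (rule Ionescu_Tulcea.intro)
  fix i
  show "run_kernel M s \<sigma> i \<in>
      measurable (PiM {0..<i} (\<lambda>_. count_space UNIV)) (subprob_algebra (count_space UNIV))"
    by (subst measurable_cong_sets[OF _ refl, where M' = "count_space (PiE {0..<i} (\<lambda>_. UNIV))"])
       (auto simp: count_space_PiM_finite run_kernel_def space_subprob_algebra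
             intro!: measure_pmf.subprob_space_axioms)
next
  fix i and x :: "nat \<Rightarrow> 's"
  show "prob_space (run_kernel M s \<sigma> i x)"
    by (simp add: run_kernel_def measure_pmf.prob_space_axioms)
qed

lemma space_run_measure [simp]: "space (run_measure M s \<sigma>) = UNIV"
  and sets_run_measure [measurable_cong]:
    "sets (run_measure M s \<sigma>) = sets (PiM UNIV (\<lambda>_. count_space UNIV))"
proof -
  interpret Ionescu_Tulcea "run_kernel M s \<sigma>" "\<lambda>_. count_space UNIV"
    by (rule Ionescu_Tulcea_run_kernel)
  show "space (run_measure M s \<sigma>) = UNIV"
    "sets (run_measure M s \<sigma>) = sets (PiM UNIV (\<lambda>_. count_space UNIV))"
    by (simp_all add: run_measure_def space_PiM)
qed

lemma prob_space_run_measure: "prob_space (run_measure M s \<sigma>)"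
proof -
  interpret Ionescu_Tulcea "run_kernel M s \<sigma>" "\<lambda>_. count_space UNIV"
    by (rule Ionescu_Tulcea_run_kernel)
  have "emeasure PF.lim (PF.emb UNIV {} {\<lambda>_. undefined}) = emeasure (CI {}) {\<lambda>_. undefined}"
    by (rule lim) (auto simp: sets_PiM_empty)
  moreover have "emeasure (CI {}) (space (CI {})) = 1"
    using PF.prob_space_P[of "{}"] by (intro prob_space.emeasure_space_1) auto
  moreover have "space (CI {}) = {\<lambda>_. undefined}"
    by (simp add: PF.space_P space_PiM)
  moreover have "PF.emb UNIV {} {\<lambda>_. undefined} = space PF.lim"
    by (auto simp: prod_emb_def space_PiM)
  ultimately show ?thesis
    unfolding run_measure_def by (intro prob_spaceI) simp
qed

lemma measure_run_cylinder:
  fixes M :: "('s::countable) mdp"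
  shows "run_prob M s \<sigma> {\<omega>. \<forall>i\<le>n. \<omega> i = f i} =
    (if f 0 = s then \<Prod>i<n. pmf (next_state M \<sigma> (map f [0..<Suc i])) (f (Suc i)) else 0)"
proof -
  interpret Ionescu_Tulcea "run_kernel M s \<sigma>" "\<lambda>_. count_space UNIV"
    by (rule Ionescu_Tulcea_run_kernel)
  let ?M = "\<lambda>_::nat. count_space (UNIV :: 's set)"
  let ?g = "\<lambda>n. restrict f {0..<n}"
  let ?p = "\<lambda>i. if i = 0 then return_pmf s else next_state M \<sigma> (map f [0..<i])"
  have sg: "{?g n} \<in> sets (PiM {0..<n} ?M)" for n
    by (simp add: sets_PiM_count_space_finite)
  have sp: "?g n \<in> space (PiM {0..<n} ?M)" for n
    by (simp add: space_PiM)
  have C: "emeasure (C 0 n (\<lambda>_. undefined)) {?g n} = ennreal (\<Prod>i<n. pmf (?p i) (f i))" for n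
  proof (induction n)
    case 0
    show ?case
      by (simp add: emeasure_return sets_PiM_empty restrict_def)
  next
    case (Suc n)
    have pre: "x \<in> space (PiM {0..<n} ?M) \<Longrightarrow>
        (\<lambda>y. x(n := y)) -` {?g (Suc n)} \<inter> UNIV = (if x = ?g n then {f n} else {})" for x
    proof -
      assume "x \<in> space (PiM {0..<n} ?M)"
      then have x: "x i = undefined" if "\<not> i < n" for i
        using that by (auto simp: space_PiM PiE_iff extensional_def)
      have "x(n := y) = ?g (Suc n) \<longleftrightarrow> x = ?g n \<and> y = f n" for y
      proof
        assume eq: "x(n := y) = ?g (Suc n)"
        have "x i = ?g n i" for i
          using fun_cong[OF eq, of i] x[of i] by (cases "i = n") (auto split: if_splits)
        then show "x = ?g n \<and> y = f n"
          using fun_cong[OF eq, of n] by auto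
      qed (auto simp: fun_eq_iff)
      then show ?thesis by auto
    qed
    have eP: "emeasure (eP n x) {?g (Suc n)} = ennreal (pmf (?p n) (f n)) * indicator {?g n} x"
      if "x \<in> space (PiM {0..<n} ?M)" for x
    proof -
      have "map (?g n) [0..<n] = map f [0..<n]"
        by (rule map_cong) auto
      then have "run_kernel M s \<sigma> n (?g n) = measure_pmf (?p n)"
        unfolding run_kernel_def by (cases "n = 0") (simp_all only: if_True if_False simp_thms)
      then show ?thesis
        using that emeasure_eP[OF that sg] pre[OF that]
        by (auto simp: emeasure_pmf_single split: split_indicator)
    qed
    have "emeasure (C 0 (Suc n) (\<lambda>_. undefined)) {?g (Suc n)} =
        (\<integral>\<^sup>+x. emeasure (eP n x) {?g (Suc n)} \<partial>C 0 n (\<lambda>_. undefined))"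
      using sg[of "Suc n"] measurable_eP[of n] sets_C[of "\<lambda>_. undefined" 0 n]
      by (simp, subst emeasure_bind[where N = "PiM {0..<Suc n} ?M"])
         (auto simp: space_C space_PiM measurable_cong_sets[OF sets_C refl])
    also have "\<dots> = (\<integral>\<^sup>+x. ennreal (pmf (?p n) (f n)) * indicator {?g n} x \<partial>C 0 n (\<lambda>_. undefined))"
    proof (intro nn_integral_cong)
      fix x assume "x \<in> space (C 0 n (\<lambda>_. undefined))"
      then have "x \<in> space (PiM {0..<n} ?M)"
        by (simp add: space_C space_PiM)
      from eP[OF this] show "emeasure (eP n x) {?g (Suc n)} =
        ennreal (pmf (?p n) (f n)) * indicator {?g n} x" .
    qed
    also have "\<dots> = ennreal (pmf (?p n) (f n)) * emeasure (C 0 n (\<lambda>_. undefined)) {?g n}"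
      using sg[of n] by (intro nn_integral_cmult_indicator) (simp add: sets_C space_PiM)
    also have "\<dots> = ennreal (\<Prod>i<Suc n. pmf (?p i) (f i))"
      unfolding Suc.IH prod.lessThan_Suc
      by (subst mult.commute, rule ennreal_mult[symmetric]) (auto intro!: prod_nonneg simp del: upt_Suc)
    finally show ?case .
  qed
  have "PF.emb UNIV {0..<Suc n} {?g (Suc n)} = {\<omega>. \<forall>i\<le>n. \<omega> i = f i}"
    by (auto simp: prod_emb_def space_PiM restrict_def fun_eq_iff less_Suc_eq_le) meson
  then have "emeasure PF.lim {\<omega>. \<forall>i\<le>n. \<omega> i = f i} = emeasure (CI {0..<Suc n}) {?g (Suc n)}"
    using lim[of "{0..<Suc n}" "{?g (Suc n)}"] sg by simp
  also have "\<dots> = emeasure (C 0 (Suc n) (\<lambda>_. undefined)) {?g (Suc n)}"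
    using emeasure_CI[of "{0..<Suc n}" "Suc n" "{?g (Suc n)}"] sg
    by (simp add: prod_emb_id space_PiM PiE_def del: C.simps)
  also have "\<dots> = ennreal (\<Prod>i<Suc n. pmf (?p i) (f i))"
    by (rule C)
  finally have "run_prob M s \<sigma> {\<omega>. \<forall>i\<le>n. \<omega> i = f i} = (\<Prod>i<Suc n. pmf (?p i) (f i))"
    by (simp add: run_prob_def run_measure_def measure_def prod_nonneg del: prod.lessThan_Suc)
  then show ?thesis
    by (subst (asm) prod.lessThan_Suc_shift) (auto simp: pmf_return indicator_def)
qed

lemma sets_TP_liminf_ge_0: "TP_liminf_ge_0 M \<in> sets (run_measure M s \<sigma>)"
proof -
  have "Measurable.pred (PiM UNIV (\<lambda>_. count_space UNIV)) (\<lambda>\<omega>. is_run M \<omega> \<and>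
     liminf (\<lambda>n. ereal (\<Sum>j<n. reward M (\<omega> j, \<omega> (Suc j)))) \<ge> 0)"
    unfolding is_run_def by measurable
  then show ?thesis
    by (simp add: TP_liminf_ge_0_def sets_run_measure pred_def space_PiM)
qed

lemma wf_ex_mdp: "wf_mdp ex_mdp"
proof -
  have "\<exists>t. (s, t) \<in> edges ex_mdp" for s
    by (cases s) (auto simp: ex_mdp_def)
  moreover have "set_pmf (trans_prob ex_mdp (R i)) = edges ex_mdp `` {R i}" for i
  proof -
    have "(1 / 2 :: real) ^ (i + 1) < 1"
      using power_Suc_less_one[of "1 / 2 :: real" i] by simp
    then show ?thesis
      by (auto simp: ex_mdp_def set_pmf_bernoulli)
  qed
  ultimately show ?thesis
    unfolding wf_mdp_def by (auto simp: ex_mdp_def split: state.splits)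
qed

end

theory Submission
  imports Defs
begin

text \<open>On runs from \<open>S\<close> the total reward is \<open>- 1\<close> at \<open>T\<close> and \<open>0\<close> elsewhere, so the objective says that \<open>T\<close> is
  visited only finitely often. With finitely many modes, possibly together with a reward counter
  (which is always \<open>0\<close> at \<open>S\<close>), the probability of staying clear of \<open>T\<close> on one round trip from \<open>S\<close> is
  bounded by some \<open>d < 1\<close>, so \<open>k\<close> consecutive safe round trips have probability at most \<open>d ^ k\<close>. A
  strategy that chooses \<open>R n\<close> at time \<open>n\<close> makes the risks summable, and Borel-Cantelli
  applies.\<close>

section \<open>Prefixes of runs\<close>

text \<open>The law of the first \<open>n + 1\<close> states as a discrete distribution on lists, so
  that probabilities on runs can be bounded by induction on \<open>n\<close>;
  \<open>distr_prefix\<close> ties it to the run measure.\<close>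

primrec prefix_pmf :: "('s::countable) mdp \<Rightarrow> 's \<Rightarrow> 's strat \<Rightarrow> nat \<Rightarrow> 's list pmf" where
  "prefix_pmf M s \<sigma> 0 = return_pmf [s]"
| "prefix_pmf M s \<sigma> (Suc n) =
     bind_pmf (prefix_pmf M s \<sigma> n) (\<lambda>\<rho>. map_pmf (\<lambda>x. \<rho> @ [x]) (next_state M \<sigma> \<rho>))"

lemma pmf_prefix_snoc:
  "pmf (prefix_pmf M s \<sigma> (Suc n)) (\<rho> @ [x]) = pmf (prefix_pmf M s \<sigma> n) \<rho> * pmf (next_state M \<sigma> \<rho>) x"
proof -
  have "pmf (map_pmf (\<lambda>x. \<rho>' @ [x]) (next_state M \<sigma> \<rho>')) (\<rho> @ [x])
      = indicator {\<rho>} \<rho>' * pmf (next_state M \<sigma> \<rho>) x" for \<rho>'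
  proof (cases "\<rho>' = \<rho>")
    case True
    then show ?thesis
      using pmf_map_inj'[of "\<lambda>x. \<rho> @ [x]" "next_state M \<sigma> \<rho>" x] by (simp add: inj_def)
  next
    case False
    then show ?thesis
      by (simp add: pmf_eq_0_set_pmf) auto
  qed
  then show ?thesis
    by (simp add: pmf_bind measure_pmf_single)
qed

lemma length_prefix: "\<rho> \<in> set_pmf (prefix_pmf M s \<sigma> n) \<Longrightarrow> length \<rho> = Suc n"
  by (induction n arbitrary: \<rho>) auto

lemma pmf_prefix:
  "pmf (prefix_pmf M s \<sigma> n) (map f [0..<Suc n]) =
    (if f 0 = s then \<Prod>i<n. pmf (next_state M \<sigma> (map f [0..<Suc i])) (f (Suc i)) else 0)"
proof (induction n)
  case 0
  show ?case by (simp add: pmf_return)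
next
  case (Suc n)
  have "map f [0..<Suc (Suc n)] = map f [0..<Suc n] @ [f (Suc n)]"
    by simp
  then show ?case
    by (simp only: pmf_prefix_snoc Suc.IH) simp
qed

lemma Collect_in_sets_run_measure:
  assumes "Measurable.pred (PiM UNIV (\<lambda>_. count_space UNIV)) P"
  shows "{\<omega>. P \<omega>} \<in> sets (run_measure M s \<sigma>)"
  using assms by (simp add: pred_def sets_run_measure space_PiM)

text \<open>There are only countably many lists, so preimages of single lists suffice; each is a
  finite-dimensional cylinder or empty.\<close>

lemma measurable_prefix:
  "(\<lambda>\<omega>. map \<omega> [0..<n]) \<in> measurable (run_measure M s \<sigma>) (count_space (UNIV :: 's::countable list set))"
proof -
  have "(\<lambda>\<omega>. map \<omega> [0..<n]) -` {a} \<inter> space (run_measure M s \<sigma>) \<in> sets (run_measure M s \<sigma>)" for a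
  proof -
    have "Measurable.pred (PiM UNIV (\<lambda>_. count_space UNIV)) (\<lambda>\<omega>::nat \<Rightarrow> 's. \<forall>i<n. \<omega> i = a ! i)"
      by measurable
    then have "{\<omega>. \<forall>i<n. \<omega> i = a ! i} \<in> sets (run_measure M s \<sigma>)"
      by (rule Collect_in_sets_run_measure)
    moreover have "(\<lambda>\<omega>. map \<omega> [0..<n]) -` {a} = (if length a = n then {\<omega>. \<forall>i<n. \<omega> i = a ! i} else {})"
      by (auto simp: list_eq_iff_nth_eq[of _ a])
    ultimately show ?thesis
      by simp
  qed
  then show ?thesis
    by (subst measurable_count_space_eq2_countable) auto
qed

text \<open>Measures on countably many lists agree once they agree on singletons. A list of length
  \<open>Suc n\<close> pulls back to a cylinder, where \<open>measure_run_cylinder\<close> and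
  \<open>pmf_prefix\<close> give the same product; any other list has mass 0 on both sides.\<close>

lemma distr_prefix:
  fixes M :: "('s::countable) mdp"
  shows "distr (run_measure M s \<sigma>) (count_space UNIV) (\<lambda>\<omega>. map \<omega> [0..<Suc n])
    = measure_pmf (prefix_pmf M s \<sigma> n)" (is "?D = _")
proof (rule measure_eqI_countable[where A = UNIV])
  fix a :: "'s list"
  interpret prob_space "run_measure M s \<sigma>"
    by (rule prob_space_run_measure)
  have D: "emeasure ?D {a} = emeasure (run_measure M s \<sigma>) {\<omega>. map \<omega> [0..<Suc n] = a}"
    by (subst emeasure_distr[OF measurable_prefix]) (auto intro!: arg_cong2[where f = emeasure])
  show "emeasure ?D {a} = emeasure (measure_pmf (prefix_pmf M s \<sigma> n)) {a}"
  proof (cases "length a = Suc n")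
    case True
    define f where "f i = a ! i" for i
    have a: "a = map f [0..<Suc n]"
      using True by (auto simp: list_eq_iff_nth_eq f_def simp del: upt_Suc)
    have "{\<omega>. map \<omega> [0..<Suc n] = a} = {\<omega>. \<forall>i\<le>n. \<omega> i = f i}"
      unfolding a by (auto simp: list_eq_iff_nth_eq less_Suc_eq_le simp del: upt_Suc)
    then have "emeasure ?D {a} = ennreal (run_prob M s \<sigma> {\<omega>. \<forall>i\<le>n. \<omega> i = f i})"
      by (simp only: D run_prob_def emeasure_eq_measure)
    also have "\<dots> = ennreal (pmf (prefix_pmf M s \<sigma> n) a)"
      unfolding a by (simp only: measure_run_cylinder pmf_prefix)
    finally show ?thesis
      by (simp add: emeasure_pmf_single)
  next
    case False
    then have "{\<omega>. map \<omega> [0..<Suc n] = a} = {}"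
      by auto
    moreover have "pmf (prefix_pmf M s \<sigma> n) a = 0"
      using False length_prefix[of a M s \<sigma> n] by (auto simp: pmf_eq_0_set_pmf)
    ultimately show ?thesis
      by (simp only: D emeasure_pmf_single emeasure_empty ennreal_0)
  qed
qed auto

lemma prob_prefix:
  "measure (run_measure M s \<sigma>) {\<omega>. map \<omega> [0..<Suc n] \<in> A} = measure_pmf.prob (prefix_pmf M s \<sigma> n) A"
proof -
  have "measure_pmf.prob (prefix_pmf M s \<sigma> n) A
      = measure (distr (run_measure M s \<sigma>) (count_space UNIV) (\<lambda>\<omega>. map \<omega> [0..<Suc n])) A"
    by (simp only: distr_prefix)
  also have "\<dots> = measure (run_measure M s \<sigma>) {\<omega>. map \<omega> [0..<Suc n] \<in> A}"
    by (subst measure_distr[OF measurable_prefix]) (auto intro!: arg_cong2[where f = measure])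
  finally show ?thesis by simp
qed

lemma AE_prefix:
  "AE \<omega> in run_measure M s \<sigma>. map \<omega> [0..<Suc n] \<in> set_pmf (prefix_pmf M s \<sigma> n)"
proof -
  have "AE \<rho> in distr (run_measure M s \<sigma>) (count_space UNIV) (\<lambda>\<omega>. map \<omega> [0..<Suc n]).
      \<rho> \<in> set_pmf (prefix_pmf M s \<sigma> n)"
    unfolding distr_prefix by (rule AE_pmfI)
  then show ?thesis
    by (subst (asm) AE_distr_iff[OF measurable_prefix]) auto
qed

lemma partial_run_snoc:
  assumes "partial_run M \<rho>" "(last \<rho>, x) \<in> edges M"
  shows "partial_run M (\<rho> @ [x])"
  using assms unfolding partial_run_def
  by (auto simp: nth_append last_conv_nth less_Suc_eq) (metis diff_Suc_1')

lemma set_next_state: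
  assumes "wf_mdp M" "strategy M \<sigma>" "partial_run M \<rho>"
  shows "set_pmf (next_state M \<sigma> \<rho>) \<subseteq> edges M `` {last \<rho>}"
  using assms unfolding next_state_def strategy_def wf_mdp_def by auto

lemma set_prefix:
  assumes "wf_mdp M" "strategy M \<sigma>" "\<rho> \<in> set_pmf (prefix_pmf M s \<sigma> n)"
  shows "partial_run M \<rho> \<and> hd \<rho> = s"
  using assms(3)
proof (induction n arbitrary: \<rho>)
  case 0
  then show ?case by (auto simp: partial_run_def)
next
  case (Suc n)
  then obtain \<rho>' x where \<rho>: "\<rho> = \<rho>' @ [x]" "\<rho>' \<in> set_pmf (prefix_pmf M s \<sigma> n)"
    "x \<in> set_pmf (next_state M \<sigma> \<rho>')"
    by auto
  then have "partial_run M \<rho>'" "hd \<rho>' = s" "(last \<rho>', x) \<in> edges M"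
    using Suc.IH[OF \<rho>(2)] set_next_state[OF assms(1,2)] by blast+
  then show ?case
    using partial_run_snoc[of M \<rho>' x] by (auto simp: \<rho>(1) partial_run_def)
qed

text \<open>The run measure lives on all state sequences, so edges are respected only almost surely:
  one null set is discarded for each prefix length, and each transition is then read off a prefix
  that covers it.\<close>

lemma AE_is_run:
  assumes "wf_mdp M" "strategy M \<sigma>"
  shows "AE \<omega> in run_measure M s \<sigma>. is_run M \<omega> \<and> \<omega> 0 = s"
proof -
  have "AE \<omega> in run_measure M s \<sigma>. \<forall>n. map \<omega> [0..<Suc n] \<in> set_pmf (prefix_pmf M s \<sigma> n)"
    by (simp only: AE_all_countable) (intro allI AE_prefix)
  then show ?thesis
  proof (rule AE_mp, intro AE_I2 impI)
    fix \<omega> :: "nat \<Rightarrow> 'a"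
    assume *: "\<forall>n. map \<omega> [0..<Suc n] \<in> set_pmf (prefix_pmf M s \<sigma> n)"
    have "(\<omega> j, \<omega> (Suc j)) \<in> edges M" for j
    proof -
      have "partial_run M (map \<omega> [0..<Suc (Suc j)])"
        using set_prefix[OF assms *[rule_format, of "Suc j"]] by blast
      then have "(map \<omega> [0..<Suc (Suc j)] ! j, map \<omega> [0..<Suc (Suc j)] ! Suc j) \<in> edges M"
        unfolding partial_run_def by (auto simp del: upt_Suc)
      then show ?thesis
        by (simp del: upt_Suc)
    qed
    moreover have "\<omega> 0 = s"
      using spec[OF *, of 0] by simp
    ultimately show "is_run M \<omega> \<and> \<omega> 0 = s"
      by (simp add: is_run_def)
  qed
qed

text \<open>Conditioning on the first stage: \<open>B\<close> can be reached only through
  \<open>A\<close>, and from there with probability at most \<open>d\<close>. This drives both the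
  geometric decay of safe round trips and the bound on visits to \<open>T\<close>.\<close>

lemma prob_bind_pmf_le:
  assumes in_A: "\<And>x. x \<in> set_pmf p \<Longrightarrow> x \<in> A \<Longrightarrow> measure_pmf.prob (K x) B \<le> d"
    and out_A: "\<And>x. x \<in> set_pmf p \<Longrightarrow> x \<notin> A \<Longrightarrow> measure_pmf.prob (K x) B = 0"
  shows "measure_pmf.prob (bind_pmf p K) B \<le> d * measure_pmf.prob p A"
proof -
  have "measure_pmf.prob (bind_pmf p K) B = (\<integral>x. measure_pmf.prob (K x) B \<partial>measure_pmf p)"
    unfolding measure_pmf_bind
    by (rule measure_pmf.measure_bind[where N = "count_space UNIV"])
       (auto simp: space_subprob_algebra intro!: measure_pmf.subprob_space_axioms)
  also have "\<dots> \<le> (\<integral>x. d * indicator A x \<partial>measure_pmf p)"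
  proof (rule integral_mono_AE)
    show "integrable (measure_pmf p) (\<lambda>x. measure_pmf.prob (K x) B)"
      by (rule measure_pmf.integrable_const_bound[where B = 1]) auto
    show "integrable (measure_pmf p) (\<lambda>x. d * indicator A x)"
      by (rule measure_pmf.integrable_const_bound[where B = "\<bar>d\<bar>"]) (auto split: split_indicator)
    show "AE x in measure_pmf p. measure_pmf.prob (K x) B \<le> d * indicator A x"
      using in_A out_A by (intro AE_pmfI) (auto split: split_indicator)
  qed
  also have "\<dots> = d * measure_pmf.prob p A"
    by simp
  finally show ?thesis .
qed

section \<open>Histories of transducers\<close>

text \<open>The appended transition is an edge at controlled states by the transducer condition. At
  random states the next state has law \<open>trans_prob\<close>, whose support is the edge set by
  \<open>wf_mdp\<close>.\<close>

lemma set_history: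
  assumes "wf_mdp M" "transducer M Q \<tau>" "m\<^sub>0 \<in> Q" "(\<rho>, m) \<in> set_pmf (history \<tau> m\<^sub>0 s n)"
  shows "partial_run M \<rho> \<and> length \<rho> = Suc n \<and> hd \<rho> = s \<and> m \<in> Q"
  using assms(4)
proof (induction n arbitrary: \<rho> m)
  case 0
  then show ?case using assms(3) by (auto simp: partial_run_def)
next
  case (Suc n)
  then obtain \<rho>' m' x where \<rho>: "\<rho> = \<rho>' @ [x]" and h: "(\<rho>', m') \<in> set_pmf (history \<tau> m\<^sub>0 s n)"
    and x: "(m, x) \<in> set_pmf (\<tau> m' (last \<rho>'))"
    by auto
  note IH = Suc.IH[OF h]
  have "m' \<in> Q"
    using IH by simp
  with assms(2) have tau: "fst ` set_pmf (\<tau> m' (last \<rho>')) \<subseteq> Q"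
      "if last \<rho>' \<in> controlled M then snd ` set_pmf (\<tau> m' (last \<rho>')) \<subseteq> edges M `` {last \<rho>'}
       else map_pmf snd (\<tau> m' (last \<rho>')) = trans_prob M (last \<rho>')"
    unfolding transducer_def by blast+
  have "m \<in> Q" "x \<in> snd ` set_pmf (\<tau> m' (last \<rho>'))"
    using tau(1) x by force+
  have "(last \<rho>', x) \<in> edges M"
  proof (cases "last \<rho>' \<in> controlled M")
    case False
    then have "snd ` set_pmf (\<tau> m' (last \<rho>')) = edges M `` {last \<rho>'}"
      using tau(2) assms(1) unfolding wf_mdp_def by (metis set_map_pmf)
    then show ?thesis
      using \<open>x \<in> snd ` set_pmf (\<tau> m' (last \<rho>'))\<close> by blast
  next
    case True
    then show ?thesis
      using tau(2) \<open>x \<in> snd ` set_pmf (\<tau> m' (last \<rho>'))\<close> by auto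
  qed
  with \<open>m \<in> Q\<close> show ?case
    using IH partial_run_snoc[of M \<rho>' x] by (auto simp: \<rho> partial_run_def)
qed

lemma total_reward_snoc:
  "\<rho> \<noteq> [] \<Longrightarrow> total_reward M (\<rho> @ [x]) = total_reward M \<rho> + reward M (last \<rho>, x)"
  unfolding total_reward_def
  by (cases "length \<rho>") (auto simp: nth_append last_conv_nth intro!: sum.cong)

text \<open>The counter is a function of the partial run, so in the example its value at
  \<open>S\<close> is forced.\<close>

lemma history_counts_reward:
  assumes "wf_mdp M" "transducer M (Q \<times> UNIV) \<tau>" "counts_reward M Q \<tau>" "q\<^sub>0 \<in> Q"
    and "(\<rho>, (q, x)) \<in> set_pmf (history \<tau> (q\<^sub>0, 0) s n)"
  shows "x = total_reward M \<rho>"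
  using assms(5)
proof (induction n arbitrary: \<rho> q x)
  case 0
  then show ?case by (simp add: total_reward_def)
next
  case (Suc n)
  then obtain \<rho>' q' x' y where \<rho>: "\<rho> = \<rho>' @ [y]"
    and h: "(\<rho>', (q', x')) \<in> set_pmf (history \<tau> (q\<^sub>0, 0) s n)"
    and y: "((q, x), y) \<in> set_pmf (\<tau> (q', x') (last \<rho>'))"
    by auto
  have "partial_run M \<rho>'" "q' \<in> Q"
    using set_history[OF assms(1,2) _ h] assms(4) by auto
  then show ?case
    using Suc.IH[OF h] y assms(3) unfolding counts_reward_def
    by (auto simp: \<rho> total_reward_snoc partial_run_def)
qed

text \<open>Possibility of \<open>\<rho>\<close> makes the conditioning event positive, so that
  \<open>cond_pmf\<close> has its intended meaning.\<close>

lemma set_mode_dist: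
  assumes "possible \<tau> m\<^sub>0 s \<rho>" "m \<in> set_pmf (mode_dist \<tau> m\<^sub>0 s \<rho>)"
  shows "(\<rho>, m) \<in> set_pmf (history \<tau> m\<^sub>0 s (length \<rho> - 1))"
proof -
  have "set_pmf (history \<tau> m\<^sub>0 s (length \<rho> - 1)) \<inter> {h. fst h = \<rho>} \<noteq> {}"
    using assms(1) unfolding possible_def by auto
  then show ?thesis
    using assms(2) unfolding mode_dist_def by (auto simp: set_cond_pmf)
qed

text \<open>\<open>implements\<close> constrains \<open>\<sigma>\<close> only on possible partial
  runs, and the runs generated by \<open>\<sigma>\<close> never leave that domain. At a controlled
  state the next state comes from some mode in \<open>mode_dist\<close>; at a random state every
  mode yields the law \<open>trans_prob\<close>.\<close>

lemma possible_prefix: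
  assumes "wf_mdp M" "transducer M Q \<tau>" "m\<^sub>0 \<in> Q" "implements M s \<tau> m\<^sub>0 \<sigma>"
    and "\<rho> \<in> set_pmf (prefix_pmf M s \<sigma> n)"
  shows "possible \<tau> m\<^sub>0 s \<rho>"
  using assms(5)
proof (induction n arbitrary: \<rho>)
  case 0
  then show ?case by (simp add: possible_def)
next
  case (Suc n)
  then obtain \<rho>' x where \<rho>: "\<rho> = \<rho>' @ [x]" and \<rho>': "\<rho>' \<in> set_pmf (prefix_pmf M s \<sigma> n)"
    and x: "x \<in> set_pmf (next_state M \<sigma> \<rho>')"
    by auto
  have pos: "possible \<tau> m\<^sub>0 s \<rho>'" and len: "length \<rho>' = Suc n"
    using Suc.IH[OF \<rho>'] length_prefix[OF \<rho>'] by auto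
  have "\<exists>m m'. (\<rho>', m) \<in> set_pmf (history \<tau> m\<^sub>0 s n) \<and> (m', x) \<in> set_pmf (\<tau> m (last \<rho>'))"
  proof (cases "last \<rho>' \<in> controlled M")
    case True
    then have "\<sigma> \<rho>' = induced_strat \<tau> m\<^sub>0 s \<rho>'"
      using pos assms(4) unfolding implements_def by auto
    then show ?thesis
      using x True set_mode_dist[OF pos] len
      by (auto simp: next_state_def induced_strat_def) blast
  next
    case False
    from pos len obtain m where m: "(\<rho>', m) \<in> set_pmf (history \<tau> m\<^sub>0 s n)"
      unfolding possible_def by auto
    then have "map_pmf snd (\<tau> m (last \<rho>')) = trans_prob M (last \<rho>')"
      using set_history[OF assms(1-3) m] assms(2) False unfolding transducer_def by auto
    then have "x \<in> set_pmf (map_pmf snd (\<tau> m (last \<rho>')))"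
      using x False by (simp add: next_state_def)
    then obtain m' where "(m', x) \<in> set_pmf (\<tau> m (last \<rho>'))"
      by auto
    then show ?thesis
      using m by blast
  qed
  then obtain m m' where "(\<rho>', m) \<in> set_pmf (history \<tau> m\<^sub>0 s n)" "(m', x) \<in> set_pmf (\<tau> m (last \<rho>'))"
    by blast
  then have "(\<rho>, m') \<in> set_pmf (history \<tau> m\<^sub>0 s (Suc n))"
    unfolding \<rho> by force
  then show ?case
    using len unfolding possible_def \<rho>
    by (intro image_eqI[of _ _ "(\<rho>' @ [x], m')"]) (simp_all del: history.simps)
qed

section \<open>The example\<close>

lemma ex_mdp_simps [simp]:
  "controlled ex_mdp = {S, T}"
  "reward ex_mdp = (\<lambda>e. case e of (R i, T) \<Rightarrow> - 1 | (T, S) \<Rightarrow> 1 | _ \<Rightarrow> 0)"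
  "trans_prob ex_mdp (R i) = map_pmf (\<lambda>b. if b then T else S) (bernoulli_pmf ((1 / 2) ^ (i + 1)))"
  "(S, x) \<in> edges ex_mdp \<longleftrightarrow> (\<exists>i. x = R i)"
  "(T, x) \<in> edges ex_mdp \<longleftrightarrow> x = S"
  "(R i, x) \<in> edges ex_mdp \<longleftrightarrow> x = T \<or> x = S"
  by (auto simp: ex_mdp_def)

lemma set_trans_prob_R: "set_pmf (trans_prob ex_mdp (R i)) = {S, T}"
proof -
  have "R i \<notin> controlled ex_mdp"
    by simp
  then have "set_pmf (trans_prob ex_mdp (R i)) = edges ex_mdp `` {R i}"
    using wf_ex_mdp unfolding wf_mdp_def by blast
  then show ?thesis
    by (simp add: set_eq_iff Image_singleton disj_commute del: ex_mdp_simps(3))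
qed

lemma pmf_trans_prob_R_T: "pmf (trans_prob ex_mdp (R i)) T = (1 / 2) ^ (i + 1)"
proof -
  have "pmf (trans_prob ex_mdp (R i)) T = measure_pmf.prob (bernoulli_pmf ((1 / 2) ^ (i + 1))) {True}"
    unfolding ex_mdp_simps pmf_map by (rule arg_cong2[where f = measure]) (auto split: if_splits)
  also have "\<dots> = (1 / 2) ^ (i + 1)"
    by (subst measure_pmf_single, subst pmf_bernoulli_True)
       (auto intro: power_le_one simp del: power_Suc)
  finally show ?thesis .
qed

text \<open>The function that is \<open>- 1\<close> at \<open>T\<close> and 0 elsewhere is a
  potential: each edge reward is its increment and it vanishes at \<open>S\<close>, so the sum
  telescopes.\<close>

lemma sum_reward_ex_mdp:
  assumes "\<And>j. j < n \<Longrightarrow> (f j, f (Suc j)) \<in> edges ex_mdp" "f 0 = S"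
  shows "(\<Sum>j<n. reward ex_mdp (f j, f (Suc j))) = (if f n = T then - 1 else 0)"
  using assms(1)
proof (induction n)
  case 0
  then show ?case by (simp add: assms(2))
next
  case (Suc n)
  have "(f n, f (Suc n)) \<in> edges ex_mdp"
    using Suc.prems by simp
  then have "(if f n = T then - 1 else 0) + reward ex_mdp (f n, f (Suc n))
      = (if f (Suc n) = T then - 1 else 0)"
    by (cases "f n") auto
  then show ?case
    using Suc by simp
qed

lemma total_reward_ex_mdp:
  assumes "partial_run ex_mdp \<rho>" "hd \<rho> = S"
  shows "total_reward ex_mdp \<rho> = (if last \<rho> = T then - 1 else 0)"
  using assms sum_reward_ex_mdp[of "length \<rho> - 1" "\<lambda>j. \<rho> ! j"]
  unfolding partial_run_def total_reward_def by (auto simp: hd_conv_nth last_conv_nth)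

text \<open>The partial sums take only the values 0 and \<open>- 1\<close>, so their liminf is
  nonnegative exactly when \<open>- 1\<close> occurs finitely often.\<close>

lemma TP_ex_mdp_iff:
  assumes "is_run ex_mdp \<omega>" "\<omega> 0 = S"
  shows "\<omega> \<in> TP_liminf_ge_0 ex_mdp \<longleftrightarrow> (\<forall>\<^sub>F n in sequentially. \<omega> n \<noteq> T)"
proof -
  have sum: "(\<Sum>j<n. reward ex_mdp (\<omega> j, \<omega> (Suc j))) = (if \<omega> n = T then - 1 else 0)" for n
    using assms by (intro sum_reward_ex_mdp) (auto simp: is_run_def)
  have "\<omega> \<in> TP_liminf_ge_0 ex_mdp \<longleftrightarrow> 0 \<le> liminf (\<lambda>n. ereal (if \<omega> n = T then - 1 else 0))"
    unfolding TP_liminf_ge_0_def mem_Collect_eq sum using assms(1) by simp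
  also have "\<dots> \<longleftrightarrow> (\<forall>\<^sub>F n in sequentially. \<omega> n \<noteq> T)"
  proof
    assume "0 \<le> liminf (\<lambda>n. ereal (if \<omega> n = T then - 1 else 0))"
    then have "\<forall>\<^sub>F n in sequentially. ereal (- 1) < ereal (if \<omega> n = T then - 1 else 0)"
      unfolding le_Liminf_iff by (elim allE[of _ "ereal (- 1)"]) simp
    then show "\<forall>\<^sub>F n in sequentially. \<omega> n \<noteq> T"
      by (rule eventually_mono) (auto split: if_splits)
  next
    assume "\<forall>\<^sub>F n in sequentially. \<omega> n \<noteq> T"
    then show "0 \<le> liminf (\<lambda>n. ereal (if \<omega> n = T then - 1 else 0))"
      by (intro Liminf_bounded) (auto elim: eventually_mono)
  qed
  finally show ?thesis .
qed

text \<open>On a run, avoiding \<open>T\<close> from some point on means alternating between \<open>S\<close> and random states.\<close>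

lemma eventually_not_T_imp_S:
  assumes "is_run ex_mdp \<omega>" "\<forall>\<^sub>F n in sequentially. \<omega> n \<noteq> T"
  shows "\<exists>N. \<forall>i. \<omega> (N + 2 * i) = S"
proof -
  obtain N\<^sub>0 where N\<^sub>0: "\<And>n. n \<ge> N\<^sub>0 \<Longrightarrow> \<omega> n \<noteq> T"
    using assms(2) unfolding eventually_sequentially by auto
  have edge: "(\<omega> j, \<omega> (Suc j)) \<in> edges ex_mdp" for j
    using assms(1) by (simp add: is_run_def)
  \<comment> \<open>From \<open>N\<^sub>0\<close> on, a state other than \<open>S\<close> is random,
    and its successor, not being \<open>T\<close>, is \<open>S\<close>.\<close>
  define N where "N = (if \<omega> N\<^sub>0 = S then N\<^sub>0 else Suc N\<^sub>0)"
  have "\<omega> (N + 2 * i) = S" for i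
  proof (induction i)
    case 0
    show ?case
      using N\<^sub>0[of N\<^sub>0] N\<^sub>0[of "Suc N\<^sub>0"] edge[of N\<^sub>0]
      by (cases "\<omega> N\<^sub>0") (auto simp: N_def)
  next
    case (Suc i)
    have "\<omega> (N + 2 * Suc i) \<noteq> T"
      by (rule N\<^sub>0) (simp add: N_def)
    then show ?case
      using edge[of "N + 2 * i"] edge[of "Suc (N + 2 * i)"] Suc by auto
  qed
  then show ?thesis by blast
qed

section \<open>Strategies with a uniform risk\<close>

text \<open>\<open>bind_pmf (\<sigma> \<rho>) (trans_prob ex_mdp)\<close> is the law of the state two steps after \<open>\<rho>\<close>.\<close>

lemma prob_always_S_le:
  assumes str: "strategy ex_mdp \<sigma>"
    and d: "\<And>n \<rho>. \<rho> \<in> set_pmf (prefix_pmf ex_mdp S \<sigma> n) \<Longrightarrow> last \<rho> = S \<Longrightarrow>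
      pmf (bind_pmf (\<sigma> \<rho>) (trans_prob ex_mdp)) S \<le> d"
    and "0 \<le> d"
  shows "measure_pmf.prob (prefix_pmf ex_mdp S \<sigma> (N + 2 * k)) {\<rho>. \<forall>i\<le>k. \<rho> ! (N + 2 * i) = S} \<le> d ^ k"
proof (induction k)
  case 0
  show ?case by simp
next
  case (Suc k)
  let ?n = "N + 2 * k" and ?A = "\<lambda>k. {\<rho>. \<forall>i\<le>k. \<rho> ! (N + 2 * i) = S}"
  let ?K = "\<lambda>\<rho>. map_pmf (\<lambda>x. \<rho> @ [x]) (next_state ex_mdp \<sigma> \<rho>)"
  \<comment> \<open>A safe round trip from \<open>S\<close> takes two steps, so two steps of the
    prefix recursion are merged into one kernel.\<close>
  have "measure_pmf.prob (prefix_pmf ex_mdp S \<sigma> (N + 2 * Suc k)) (?A (Suc k))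
     = measure_pmf.prob (bind_pmf (prefix_pmf ex_mdp S \<sigma> ?n) (\<lambda>\<rho>. bind_pmf (?K \<rho>) ?K)) (?A (Suc k))"
    by (simp add: bind_assoc_pmf)
  also have "\<dots> \<le> d * measure_pmf.prob (prefix_pmf ex_mdp S \<sigma> ?n) (?A k)"
  proof (rule prob_bind_pmf_le)
    fix \<rho> assume \<rho>: "\<rho> \<in> set_pmf (prefix_pmf ex_mdp S \<sigma> ?n)"
    then have len: "length \<rho> = Suc ?n"
      by (rule length_prefix)
    {
      assume "\<rho> \<in> ?A k"
      then have last: "last \<rho> = S"
        using len by (subst last_conv_nth) auto
      then have "set_pmf (\<sigma> \<rho>) \<subseteq> edges ex_mdp `` {S}"
        using set_prefix[OF wf_ex_mdp str \<rho>] str[unfolded strategy_def, rule_format, of \<rho>] by simp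
      then have R: "\<exists>i. x = R i" if "x \<in> set_pmf (\<sigma> \<rho>)" for x
        using that by auto
      have "map_pmf last (bind_pmf (?K \<rho>) ?K) = bind_pmf (\<sigma> \<rho>) (\<lambda>x. next_state ex_mdp \<sigma> (\<rho> @ [x]))"
        using last by (simp add: next_state_def map_bind_pmf bind_map_pmf pmf.map_comp o_def)
      also have "\<dots> = bind_pmf (\<sigma> \<rho>) (trans_prob ex_mdp)"
        using R by (intro bind_pmf_cong) (auto simp: next_state_def)
      finally have last_K: "map_pmf last (bind_pmf (?K \<rho>) ?K) = bind_pmf (\<sigma> \<rho>) (trans_prob ex_mdp)" .
      \<comment> \<open>Of the conditions in \<open>?A (Suc k)\<close> only the newest, about the
        last state, is kept for the upper bound.\<close>
      have "measure_pmf.prob (bind_pmf (?K \<rho>) ?K) (?A (Suc k))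
          \<le> measure_pmf.prob (bind_pmf (?K \<rho>) ?K) (last -` {S})"
      proof (rule measure_pmf.finite_measure_mono_AE)
        show "AE \<rho>' in bind_pmf (?K \<rho>) ?K. \<rho>' \<in> ?A (Suc k) \<longrightarrow> \<rho>' \<in> last -` {S}"
        proof (intro AE_pmfI impI)
          fix \<rho>' assume "\<rho>' \<in> set_pmf (bind_pmf (?K \<rho>) ?K)" "\<rho>' \<in> ?A (Suc k)"
          moreover from this(1) have "length \<rho>' = Suc (N + 2 * Suc k)"
            using len by auto
          ultimately show "\<rho>' \<in> last -` {S}"
            by (subst vimage_eq, subst last_conv_nth) auto
        qed
      qed simp
      also have "\<dots> = pmf (bind_pmf (\<sigma> \<rho>) (trans_prob ex_mdp)) S"
        by (simp only: last_K[symmetric] pmf_map)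
      also have "\<dots> \<le> d"
        using d[OF \<rho> last] .
      finally show "measure_pmf.prob (bind_pmf (?K \<rho>) ?K) (?A (Suc k)) \<le> d" .
    next
      assume "\<rho> \<notin> ?A k"
      then obtain i where i: "i \<le> k" "\<rho> ! (N + 2 * i) \<noteq> S"
        by blast
      \<comment> \<open>Extending the prefix does not repair a violation at an earlier
        position.\<close>
      have "\<rho>' \<notin> ?A (Suc k)" if \<rho>': "\<rho>' \<in> set_pmf (bind_pmf (?K \<rho>) ?K)" for \<rho>'
      proof -
        obtain x y where "\<rho>' = (\<rho> @ [x]) @ [y]"
          using \<rho>' by auto
        then have "\<rho>' ! (N + 2 * i) = \<rho> ! (N + 2 * i)"
          using i(1) len by (simp add: nth_append)
        then show ?thesis
          using i by (auto intro!: exI[of _ i])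
      qed
      then have "set_pmf (bind_pmf (?K \<rho>) ?K) \<inter> ?A (Suc k) = {}"
        by blast
      then show "measure_pmf.prob (bind_pmf (?K \<rho>) ?K) (?A (Suc k)) = 0"
        by (simp only: measure_pmf_zero_iff)
    }
  qed
  also have "\<dots> \<le> d * d ^ k"
    using Suc \<open>0 \<le> d\<close> by (rule mult_left_mono)
  finally show ?case by simp
qed

text \<open>For fixed \<open>N\<close>, being at \<open>S\<close> at all times
  \<open>N + 2 * i\<close> has probability at most \<open>d ^ k\<close> for every \<open>k\<close>,
  hence 0. By \<open>eventually_not_T_imp_S\<close>, the countable union of these events over
  \<open>N\<close> contains almost every winning run.\<close>

lemma run_prob_uniform_risk:
  assumes str: "strategy ex_mdp \<sigma>"
    and d: "\<And>n \<rho>. \<rho> \<in> set_pmf (prefix_pmf ex_mdp S \<sigma> n) \<Longrightarrow> last \<rho> = S \<Longrightarrow>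
      pmf (bind_pmf (\<sigma> \<rho>) (trans_prob ex_mdp)) S \<le> d"
    and "0 \<le> d" "d < 1"
  shows "run_prob ex_mdp S \<sigma> (TP_liminf_ge_0 ex_mdp) = 0"
proof -
  interpret prob_space "run_measure ex_mdp S \<sigma>"
    by (rule prob_space_run_measure)
  have "AE \<omega> in run_measure ex_mdp S \<sigma>. \<not> (\<forall>i. \<omega> (N + 2 * i) = S)" for N
  proof -
    let ?B = "{\<omega>. \<forall>i. \<omega> (N + 2 * i) = S}"
    have "Measurable.pred (PiM UNIV (\<lambda>_. count_space UNIV)) (\<lambda>\<omega>::nat \<Rightarrow> state. \<forall>i. \<omega> (N + 2 * i) = S)"
      by measurable
    then have B: "?B \<in> events"
      by (rule Collect_in_sets_run_measure)
    have "prob ?B \<le> d ^ k" for k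
    proof -
      let ?A = "{\<rho>. \<forall>i\<le>k. \<rho> ! (N + 2 * i) = S}"
      have sub: "?B \<subseteq> {\<omega>. map \<omega> [0..<Suc (N + 2 * k)] \<in> ?A}"
        by (auto simp del: upt_Suc)
      have meas: "{\<omega>. map \<omega> [0..<Suc (N + 2 * k)] \<in> ?A} \<in> events"
        using measurable_sets[OF measurable_prefix, of ?A "Suc (N + 2 * k)" ex_mdp S \<sigma>]
        by (simp add: vimage_def del: upt_Suc)
      have "prob ?B \<le> prob {\<omega>. map \<omega> [0..<Suc (N + 2 * k)] \<in> ?A}"
        using sub meas by (rule finite_measure_mono)
      also have "\<dots> \<le> d ^ k"
        unfolding prob_prefix by (rule prob_always_S_le[OF str d \<open>0 \<le> d\<close>])
      finally show ?thesis .
    qed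
    moreover have "(\<lambda>k. d ^ k) \<longlonglongrightarrow> 0"
      using \<open>0 \<le> d\<close> \<open>d < 1\<close> by (intro LIMSEQ_power_zero) simp
    ultimately have "prob ?B \<le> 0"
      by (intro LIMSEQ_le_const) auto
    then have "prob ?B = 0"
      by (simp add: measure_le_0_iff)
    then show ?thesis
      using B prob_eq_0[of ?B] by simp
  qed
  then have "AE \<omega> in run_measure ex_mdp S \<sigma>. \<forall>N. \<not> (\<forall>i. \<omega> (N + 2 * i) = S)"
    by (simp add: AE_all_countable)
  moreover have "AE \<omega> in run_measure ex_mdp S \<sigma>. is_run ex_mdp \<omega> \<and> \<omega> 0 = S"
    by (rule AE_is_run[OF wf_ex_mdp str])
  ultimately have "AE \<omega> in run_measure ex_mdp S \<sigma>. \<omega> \<notin> TP_liminf_ge_0 ex_mdp"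
    by eventually_elim (metis TP_ex_mdp_iff eventually_not_T_imp_S)
  then show ?thesis
    unfolding run_prob_def using prob_eq_0[OF sets_TP_liminf_ge_0] by simp
qed

text \<open>Each mode in state \<open>S\<close> risks \<open>T\<close> with positive probability, and finitely many
  such modes risk it uniformly.\<close>

lemma run_prob_finite_modes:
  fixes \<tau> :: "'m \<Rightarrow> state \<Rightarrow> ('m \<times> state) pmf"
  assumes str: "strategy ex_mdp \<sigma>" and tr: "transducer ex_mdp Q \<tau>" and m\<^sub>0: "m\<^sub>0 \<in> Q"
    and imp: "implements ex_mdp S \<tau> m\<^sub>0 \<sigma>" and "finite F"
    and F: "\<And>n \<rho> m. (\<rho>, m) \<in> set_pmf (history \<tau> m\<^sub>0 S n) \<Longrightarrow> last \<rho> = S \<Longrightarrow> m \<in> F"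
  shows "run_prob ex_mdp S \<sigma> (TP_liminf_ge_0 ex_mdp) = 0"
proof -
  \<comment> \<open>The probability of being back at \<open>S\<close> two steps after leaving it in
    mode \<open>m\<close>.\<close>
  define stay where "stay m = pmf (bind_pmf (map_pmf snd (\<tau> m S)) (trans_prob ex_mdp)) S" for m
  have "stay m < 1" if "m \<in> Q" for m
  proof -
    let ?p = "bind_pmf (map_pmf snd (\<tau> m S)) (trans_prob ex_mdp)"
    obtain y where y: "y \<in> set_pmf (\<tau> m S)"
      using set_pmf_not_empty by fastforce
    moreover have "snd ` set_pmf (\<tau> m S) \<subseteq> edges ex_mdp `` {S}"
      using tr that unfolding transducer_def by auto
    ultimately obtain i where "snd y = R i"
      by force
    then have "R i \<in> set_pmf (map_pmf snd (\<tau> m S))"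
      using y by (metis image_eqI set_map_pmf)
    then have "T \<in> set_pmf ?p"
      using set_trans_prob_R[of i] unfolding set_bind_pmf by blast
    then have "0 < pmf ?p T"
      by (rule pmf_positive)
    moreover have "pmf ?p S + pmf ?p T = measure_pmf.prob ?p {S, T}"
      by (simp add: measure_measure_pmf_finite)
    moreover have "measure_pmf.prob ?p {S, T} \<le> 1"
      by simp
    ultimately show ?thesis
      unfolding stay_def by linarith
  qed
  \<comment> \<open>Inserting 0 keeps the maximum defined when \<open>F \<inter> Q\<close> is empty
    and ensures \<open>0 \<le> d\<close>.\<close>
  define d where "d = Max (insert 0 (stay ` (F \<inter> Q)))"
  have "0 \<le> d" "d < 1" and stay_le: "\<And>m. m \<in> F \<inter> Q \<Longrightarrow> stay m \<le> d"
    using \<open>finite F\<close> \<open>\<And>m. m \<in> Q \<Longrightarrow> stay m < 1\<close> by (auto simp: d_def)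
  show ?thesis
  proof (rule run_prob_uniform_risk[OF str _ \<open>0 \<le> d\<close> \<open>d < 1\<close>])
    fix n \<rho> assume \<rho>: "\<rho> \<in> set_pmf (prefix_pmf ex_mdp S \<sigma> n)" and last: "last \<rho> = S"
    have pos: "possible \<tau> m\<^sub>0 S \<rho>"
      by (rule possible_prefix[OF wf_ex_mdp tr m\<^sub>0 imp \<rho>])
    then have "\<sigma> \<rho> = induced_strat \<tau> m\<^sub>0 S \<rho>"
      using imp last unfolding implements_def by simp
    then have "bind_pmf (\<sigma> \<rho>) (trans_prob ex_mdp)
        = bind_pmf (mode_dist \<tau> m\<^sub>0 S \<rho>) (\<lambda>m. bind_pmf (map_pmf snd (\<tau> m S)) (trans_prob ex_mdp))"
      by (simp add: induced_strat_def last bind_assoc_pmf)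
    then have "pmf (bind_pmf (\<sigma> \<rho>) (trans_prob ex_mdp)) S
        = measure_pmf.expectation (mode_dist \<tau> m\<^sub>0 S \<rho>) stay"
      by (simp only: pmf_bind[of "mode_dist \<tau> m\<^sub>0 S \<rho>"] stay_def[abs_def])
    \<comment> \<open>The risk is averaged over the conditional mode distribution, which is
      supported in \<open>F \<inter> Q\<close>.\<close>
    also have "\<dots> \<le> d"
    proof (rule measure_pmf.integral_le_const)
      show "integrable (mode_dist \<tau> m\<^sub>0 S \<rho>) stay"
        by (rule measure_pmf.integrable_const_bound[where B = 1]) (auto simp: stay_def pmf_le_1)
      show "AE m in mode_dist \<tau> m\<^sub>0 S \<rho>. stay m \<le> d"
      proof (rule AE_pmfI)
        fix m assume "m \<in> set_pmf (mode_dist \<tau> m\<^sub>0 S \<rho>)"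
        from set_mode_dist[OF pos this] have "m \<in> F \<inter> Q"
          using F last set_history[OF wf_ex_mdp tr m\<^sub>0] by blast
        then show "stay m \<le> d"
          by (rule stay_le)
      qed
    qed
    finally show "pmf (bind_pmf (\<sigma> \<rho>) (trans_prob ex_mdp)) S \<le> d" .
  qed
qed

lemma run_prob_FR:
  assumes "FR_strategy ex_mdp S \<sigma>"
  shows "run_prob ex_mdp S \<sigma> (TP_liminf_ge_0 ex_mdp) = 0"
proof -
  obtain Q :: "nat set" and m\<^sub>0 \<tau> where Q: "strategy ex_mdp \<sigma>" "finite Q" "m\<^sub>0 \<in> Q"
    "transducer ex_mdp Q \<tau>" "implements ex_mdp S \<tau> m\<^sub>0 \<sigma>"
    using assms unfolding FR_strategy_def by auto
  show ?thesis
    using set_history[OF wf_ex_mdp Q(4,3)] by (intro run_prob_finite_modes[OF Q(1,4,3,5,2)]) blast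
qed

text \<open>The memory \<open>Q \<times> UNIV\<close> is infinite, but at \<open>S\<close> the
  counter is always 0, so only modes in \<open>Q \<times> {0}\<close> occur there. This is why
  \<open>run_prob_finite_modes\<close> asks for finiteness only of the modes met at
  \<open>S\<close>.\<close>

lemma run_prob_FR_reward_counter:
  assumes "FR_reward_counter_strategy ex_mdp S \<sigma>"
  shows "run_prob ex_mdp S \<sigma> (TP_liminf_ge_0 ex_mdp) = 0"
proof -
  obtain Q :: "nat set" and q\<^sub>0 \<tau> where Q: "strategy ex_mdp \<sigma>" "finite Q" "q\<^sub>0 \<in> Q"
    "transducer ex_mdp (Q \<times> UNIV) \<tau>" "counts_reward ex_mdp Q \<tau>" "implements ex_mdp S \<tau> (q\<^sub>0, 0) \<sigma>"
    using assms unfolding FR_reward_counter_strategy_def by auto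
  have m: "(q\<^sub>0, 0) \<in> Q \<times> UNIV"
    using Q(3) by simp
  show ?thesis
  proof (rule run_prob_finite_modes[OF Q(1,4) m Q(6)])
    show "finite (Q \<times> {0::real})"
      using Q(2) by simp
    fix n \<rho> and m :: "nat \<times> real"
    assume h: "(\<rho>, m) \<in> set_pmf (history \<tau> (q\<^sub>0, 0) S n)" and "last \<rho> = S"
    moreover have "partial_run ex_mdp \<rho>" "hd \<rho> = S" "m \<in> Q \<times> UNIV"
      using set_history[OF wf_ex_mdp Q(4) m h] by auto
    moreover have "snd m = total_reward ex_mdp \<rho>"
      using history_counts_reward[OF wf_ex_mdp Q(4,5,3), of \<rho> "fst m" "snd m"] h by simp
    ultimately show "m \<in> Q \<times> {0}"
      using total_reward_ex_mdp[of \<rho>] by (cases m) auto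
  qed
qed

section \<open>A winning strategy with infinite memory\<close>

text \<open>A list of length \<open>n\<close> ends at time \<open>n - 1\<close>, so the chosen
  \<open>R n\<close> is entered at time \<open>n\<close>: the index equals the time of the
  visit.\<close>

definition step_counting :: "state strat" where
  "step_counting \<rho> = return_pmf (if last \<rho> = S then R (length \<rho>) else S)"

lemma HD_step_counting: "HD_strategy ex_mdp step_counting"
  unfolding HD_strategy_def strategy_def step_counting_def by auto

lemma step_counting_index:
  assumes "\<rho> \<in> set_pmf (prefix_pmf ex_mdp S step_counting n)" "last \<rho> = R i"
  shows "i = n"
proof (cases n)
  case 0
  then show ?thesis using assms by simp
next
  case (Suc k)
  with assms obtain \<rho>' where "\<rho>' \<in> set_pmf (prefix_pmf ex_mdp S step_counting k)"
    and x: "R i \<in> set_pmf (next_state ex_mdp step_counting \<rho>')"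
    by auto
  then have "length \<rho>' = Suc k"
    by (intro length_prefix)
  then show ?thesis
    using x Suc by (cases "last \<rho>'") (auto simp: next_state_def step_counting_def)
qed

text \<open>\<open>T\<close> is entered only from a random state, which at time \<open>k\<close> is
  \<open>R k\<close> with risk \<open>(1 / 2) ^ (k + 1)\<close>. The bound holds for every prefix,
  so \<open>prob_bind_pmf_le\<close> is applied with \<open>A = UNIV\<close>.\<close>

lemma prob_step_counting_T:
  "measure_pmf.prob (prefix_pmf ex_mdp S step_counting n) {\<rho>. last \<rho> = T} \<le> (1 / 2) ^ n"
proof (cases n)
  case 0
  then show ?thesis by simp
next
  case (Suc k)
  have "measure_pmf.prob (prefix_pmf ex_mdp S step_counting (Suc k)) {\<rho>. last \<rho> = T}
      \<le> (1 / 2) ^ (k + 1) * measure_pmf.prob (prefix_pmf ex_mdp S step_counting k) UNIV"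
    unfolding prefix_pmf.simps
  proof (rule prob_bind_pmf_le)
    fix \<rho> assume \<rho>: "\<rho> \<in> set_pmf (prefix_pmf ex_mdp S step_counting k)"
    have "measure_pmf.prob (map_pmf (\<lambda>x. \<rho> @ [x]) (next_state ex_mdp step_counting \<rho>)) {\<rho>. last \<rho> = T}
        = pmf (next_state ex_mdp step_counting \<rho>) T"
      by (simp add: measure_map_pmf vimage_def measure_pmf_single)
    also have "\<dots> \<le> (1 / 2) ^ (k + 1)"
    proof (cases "last \<rho>")
      case (R i)
      then show ?thesis
        using step_counting_index[OF \<rho> R] pmf_trans_prob_R_T[of i]
        by (simp add: next_state_def del: ex_mdp_simps(3))
    qed (auto simp: next_state_def step_counting_def pmf_return)
    finally show "measure_pmf.prob (map_pmf (\<lambda>x. \<rho> @ [x]) (next_state ex_mdp step_counting \<rho>))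
        {\<rho>. last \<rho> = T} \<le> (1 / 2) ^ (k + 1)" .
  qed simp
  then show ?thesis
    using Suc by simp
qed

lemma run_prob_step_counting: "run_prob ex_mdp S step_counting (TP_liminf_ge_0 ex_mdp) = 1"
proof -
  let ?M = "run_measure ex_mdp S step_counting"
  interpret prob_space ?M
    by (rule prob_space_run_measure)
  \<comment> \<open>As an event about prefixes, being at \<open>T\<close> at time \<open>n\<close>
    falls under \<open>prob_prefix\<close>.\<close>
  have T_eq: "{\<omega>. \<omega> n = T} = {\<omega>. map \<omega> [0..<Suc n] \<in> {\<rho>. last \<rho> = T}}" for n
    by auto
  have T_events: "{\<omega>. \<omega> n = T} \<in> events" for n
    using measurable_sets[OF measurable_prefix, of "{\<rho>. last \<rho> = T}" "Suc n" ex_mdp S step_counting]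
    unfolding T_eq by (simp add: vimage_def)
  have "AE \<omega> in ?M. \<forall>\<^sub>F n in sequentially. \<omega> \<in> space ?M - {\<omega>. \<omega> n = T}"
  proof (rule borel_cantelli_AE1[OF T_events])
    have "prob {\<omega>. \<omega> n = T} \<le> (1 / 2) ^ n" for n
      by (simp only: T_eq[of n] prob_prefix prob_step_counting_T)
    then show "summable (\<lambda>n. prob {\<omega>. \<omega> n = T})"
      by (intro summable_comparison_test[OF _ summable_geometric[of "1 / 2 :: real"]]) auto
  qed (simp add: emeasure_eq_measure)
  moreover have "AE \<omega> in ?M. is_run ex_mdp \<omega> \<and> \<omega> 0 = S"
    using HD_step_counting by (intro AE_is_run[OF wf_ex_mdp]) (simp add: HD_strategy_def)
  ultimately have "AE \<omega> in ?M. \<omega> \<in> TP_liminf_ge_0 ex_mdp"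
    by eventually_elim (simp add: TP_ex_mdp_iff)
  then show ?thesis
    unfolding run_prob_def by (intro prob_eq_1[OF sets_TP_liminf_ge_0, THEN iffD2])
qed

text \<open>The bound 1 is attained by \<open>step_counting\<close>, so the supremum is a maximum.
  Winning probability 0 is then too small for \<open>\<epsilon>\<close>-optimality whenever
  \<open>\<epsilon> < 1\<close>.\<close>

lemma mdp_value_ex_mdp: "mdp_value ex_mdp S (TP_liminf_ge_0 ex_mdp) = 1"
  unfolding mdp_value_def
proof (rule cSup_eq_maximum)
  show "1 \<in> (\<lambda>\<sigma>. run_prob ex_mdp S \<sigma> (TP_liminf_ge_0 ex_mdp)) ` {\<sigma>. strategy ex_mdp \<sigma>}"
    using HD_step_counting run_prob_step_counting
    by (auto simp: HD_strategy_def intro!: image_eqI[of _ _ step_counting])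
  fix x assume "x \<in> (\<lambda>\<sigma>. run_prob ex_mdp S \<sigma> (TP_liminf_ge_0 ex_mdp)) ` {\<sigma>. strategy ex_mdp \<sigma>}"
  then show "x \<le> 1"
    using prob_space.prob_le_1[OF prob_space_run_measure] by (auto simp: run_prob_def)
qed

text \<open>The range of \<open>\<epsilon>\<close> stops below 1 because the value is 1, so for
  \<open>\<epsilon> \<ge> 1\<close> every strategy is \<open>\<epsilon>\<close>-optimal. The
  existence of an optimal strategy ensures that the final negative claims concern attainable
  goals.\<close>

theorem theorem5p6:
  shows "(\<forall>\<rho>. partial_run ex_mdp \<rho> \<and> hd \<rho> = S \<longrightarrow>
            total_reward ex_mdp \<rho> = (if last \<rho> = T then - 1 else 0)) \<and>
    (\<forall>\<sigma>. FR_strategy ex_mdp S \<sigma> \<longrightarrow> run_prob ex_mdp S \<sigma> (TP_liminf_ge_0 ex_mdp) = 0) \<and>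
    (\<exists>\<sigma>. HD_strategy ex_mdp \<sigma> \<and> run_prob ex_mdp S \<sigma> (TP_liminf_ge_0 ex_mdp) = 1) \<and>
    (\<exists>\<sigma>. optimal ex_mdp S (TP_liminf_ge_0 ex_mdp) \<sigma> \<and> almost_surely_winning ex_mdp S (TP_liminf_ge_0 ex_mdp) \<sigma>) \<and>
    (\<forall>\<sigma>. FR_reward_counter_strategy ex_mdp S \<sigma> \<longrightarrow>
       \<not> almost_surely_winning ex_mdp S (TP_liminf_ge_0 ex_mdp) \<sigma> \<and>
       \<not> optimal ex_mdp S (TP_liminf_ge_0 ex_mdp) \<sigma> \<and>
       (\<forall>\<epsilon>. 0 < \<epsilon> \<and> \<epsilon> < 1 \<longrightarrow> \<not> eps_optimal ex_mdp S (TP_liminf_ge_0 ex_mdp) \<epsilon> \<sigma>))"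
proof -
  have "strategy ex_mdp step_counting"
    using HD_step_counting by (simp add: HD_strategy_def)
  then have "optimal ex_mdp S (TP_liminf_ge_0 ex_mdp) step_counting"
    "almost_surely_winning ex_mdp S (TP_liminf_ge_0 ex_mdp) step_counting"
    by (simp_all add: optimal_def almost_surely_winning_def mdp_value_ex_mdp run_prob_step_counting)
  moreover have "\<not> almost_surely_winning ex_mdp S (TP_liminf_ge_0 ex_mdp) \<sigma>"
    "\<not> optimal ex_mdp S (TP_liminf_ge_0 ex_mdp) \<sigma>"
    "\<epsilon> < 1 \<Longrightarrow> \<not> eps_optimal ex_mdp S (TP_liminf_ge_0 ex_mdp) \<epsilon> \<sigma>"
    if "FR_reward_counter_strategy ex_mdp S \<sigma>" for \<sigma> \<epsilon>
    using run_prob_FR_reward_counter[OF that]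
    by (auto simp: almost_surely_winning_def optimal_def eps_optimal_def mdp_value_ex_mdp)
  ultimately show ?thesis
    using total_reward_ex_mdp run_prob_FR HD_step_counting run_prob_step_counting by blast
qed

end
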